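(* Let $N\in\mathbb{N}\cup\{\infty\}$ and let $R=(r_{n,k})_{n,k=0}^N$ be a lower unitriangular matrix with real entries. Define polynomials $p_n(t)$, $0\le n\le N$ ($n$ finite), by $p_0(t)=1$ and $$p_n(t)=t\sum_{k=0}^{n-1} r_{n,k}\,p_k(t),\qquad 0<n\le N .$$ If $R$ is totally nonnegative, then for each $n$ with $0\le n\le N$, all zeros of $p_n(t)$ are real and located in the interval $[-1,0]$ (unless $p_n$ is the zero polynomial). Moreover, the zeros of $p_n(t)$ interlace those of $p_{n+1}(t)$, i.e. $p_n(t)\prec p_{n+1}(t)$, for each $0\le n<N$.
   Context: $\mathbb{N}=\{0,1,2,\dots\}$. A lower unitriangular matrix is a lower triangular matrix whose diagonal entries are all equal to $1$. A real matrix (possibly infinite) is totally nonnegative (TN) if all of its (finite) minors are nonnegative. Interlacing: let $f,g\in\mathbb{R}[t]$ be real-rooted with positive leading coefficients and zeros (with multiplicity) $\cdots\le\alpha_2\le\alpha_1$ and $\cdots\le\beta_2\le\beta_1$, respectively. Then $f\prec g$ ("the zeros of $f$ interlace those of $g$") means $\cdots\le\alpha_2\le\beta_2\le\alpha_1\le\beta_1$; in particular $\deg g\in\{\deg f,\deg f+1\}$. By convention $0\prec f$ and $f\prec 0$ for every real-rooted $f$, and the zero polynomial counts as real-rooted (also $0\prec 0$). *)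

theory Defs
  imports
    Complex_Main
    "HOL-Library.Extended_Nat"
    "HOL-Computational_Algebra.Polynomial"
    "Jordan_Normal_Form.Determinant"
begin

text \<open>
  A matrix \<open>(r n k)\<close> with \<open>0 \<le> n, k \<le> N\<close>, where \<open>N\<close> may be infinite, is a function
  \<open>nat \<Rightarrow> nat \<Rightarrow> real\<close>; entries with an index beyond \<open>N\<close> are irrelevant.
\<close>

definition lower_unitriangular :: "enat \<Rightarrow> (nat \<Rightarrow> nat \<Rightarrow> real) \<Rightarrow> bool" where
  "lower_unitriangular N r \<longleftrightarrow>
     (\<forall>n. enat n \<le> N \<longrightarrow> r n n = 1) \<and>
     (\<forall>n k. enat n \<le> N \<longrightarrow> enat k \<le> N \<longrightarrow> n < k \<longrightarrow> r n k = 0)"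

definition minor :: "(nat \<Rightarrow> nat \<Rightarrow> real) \<Rightarrow> nat \<Rightarrow> (nat \<Rightarrow> nat) \<Rightarrow> (nat \<Rightarrow> nat) \<Rightarrow> real" where
  "minor r m I J = det (mat m m (\<lambda>(i, j). r (I i) (J j)))"

definition totally_nonnegative :: "enat \<Rightarrow> (nat \<Rightarrow> nat \<Rightarrow> real) \<Rightarrow> bool" where
  "totally_nonnegative N r \<longleftrightarrow>
     (\<forall>m I J. strict_mono_on {..<m} I \<longrightarrow> strict_mono_on {..<m} J \<longrightarrow>
        (\<forall>i<m. enat (I i) \<le> N \<and> enat (J i) \<le> N) \<longrightarrow> minor r m I J \<ge> 0)"

text \<open>The zero polynomial counts as real-rooted, although every number is a zero of it.\<close>

definition real_rooted :: "real poly \<Rightarrow> bool" where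
  "real_rooted f \<longleftrightarrow>
     f = 0 \<or> (\<forall>z. poly (map_poly complex_of_real f) z = 0 \<longrightarrow> z \<in> \<real>)"

text \<open>The real zeros of a nonzero polynomial, with multiplicity, in decreasing order.\<close>

definition zeros_desc :: "real poly \<Rightarrow> real list" where
  "zeros_desc f = rev (sorted_list_of_multiset (proots f))"

text \<open>
  The zeros of \<open>f\<close> interlace those of \<open>g\<close>. For nonzero \<open>f\<close> and \<open>g\<close> both leading coefficients
  are positive and, with the zeros \<open>\<alpha>\<close> of \<open>f\<close> and \<open>\<beta>\<close> of \<open>g\<close> indexed from \<open>0\<close> in decreasing
  order, \<open>\<dots> \<le> \<alpha> ! 1 \<le> \<beta> ! 1 \<le> \<alpha> ! 0 \<le> \<beta> ! 0\<close>, where the chain ends with the last zero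
  of either \<open>f\<close> or \<open>g\<close>. The zero polynomial interlaces, and is interlaced by, every
  real-rooted polynomial.
\<close>

definition interlaces :: "real poly \<Rightarrow> real poly \<Rightarrow> bool" (infix \<open>\<prec>\<^sub>I\<close> 50) where
  "f \<prec>\<^sub>I g \<longleftrightarrow> real_rooted f \<and> real_rooted g \<and>
     (f = 0 \<or> g = 0 \<or>
       (lead_coeff f > 0 \<and> lead_coeff g > 0 \<and>
        (let \<alpha> = zeros_desc f; \<beta> = zeros_desc g in
           (length \<beta> = length \<alpha> \<or> length \<beta> = length \<alpha> + 1) \<and>
           (\<forall>i < length \<alpha>. \<alpha> ! i \<le> \<beta> ! i) \<and>
           (\<forall>i. i + 1 < length \<beta> \<longrightarrow> \<beta> ! (i + 1) \<le> \<alpha> ! i))))"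

end

theory Submission
  imports
    Defs
    "HOL-Complex_Analysis.Conformal_Mappings"
    "HOL-Computational_Algebra.Fundamental_Theorem_Algebra"
begin

text \<open>
  Fix \<open>z\<close> in the open upper half plane and consider Neville elimination of \<open>R\<close>, applied to the
  vector \<open>(p\<^sub>n(z))\<close>. It starts with \<open>R p\<close>, whose \<open>n\<close>-th entry is \<open>(1 + z) / z\<close> times
  \<open>p\<^sub>n(z)\<close> for \<open>n > 0\<close>, and ends with \<open>p\<close>. If the initial
  minors of \<open>R\<close> are positive, an entry of one stage is the same entry of the next stage plus a
  nonnegative multiple of the entry above it. Therefore the stages in
  row \<open>n\<close> arise from those in row \<open>n - 1\<close> by the classical transformation that preserves
  interlacing sequences, and pointwise at \<open>z\<close> this only needs inequalities between arguments.

  A totally nonnegative unitriangular matrix is a limit of matrices with positive initial minors,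
  obtained by adding small multiples of rows to the next ones, and the inequalities survive the
  limit. They imply that \<open>p\<^sub>n\<^sub>+\<^sub>1 / (t p\<^sub>n)\<close> maps the upper half plane to the closed lower one and
  has nonnegative real part near the reals outside \<open>[-1, 0]\<close>. By the open mapping theorem it has no
  zeros off \<open>[-1, 0]\<close>, and counting zeros by the argument gives the interlacing.
\<close>

section \<open>Approximation by matrices with positive initial minors\<close>

text \<open>Left multiplication by the elementary matrix whose only off-diagonal entry is
  \<open>e\<close>, in row \<open>Suc j\<close> and column \<open>j\<close>.\<close>

definition add_row :: "real \<Rightarrow> nat \<Rightarrow> (nat \<Rightarrow> nat \<Rightarrow> real) \<Rightarrow> nat \<Rightarrow> nat \<Rightarrow> real" where
  "add_row e j A = A(Suc j := \<lambda>l. A (Suc j) l + e * A j l)"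

lemma minor_cong:
  assumes "\<And>i j. i < m \<Longrightarrow> j < m \<Longrightarrow> A (I i) (J j) = A' (I' i) (J' j)"
  shows "minor A m I J = minor A' m I' J'"
  unfolding minor_def by (rule arg_cong[where f = Determinant.det], rule eq_matI) (auto simp: assms)

lemma minor_add_row_notin:
  assumes "\<And>i. i < m \<Longrightarrow> I i \<noteq> Suc j"
  shows "minor (add_row e j A) m I J = minor A m I J"
  by (rule minor_cong) (auto simp: add_row_def assms)

text \<open>Additivity of the determinant in row \<open>s\<close>: the three matrices agree in all
  other rows, so they share the cofactors of the Laplace expansion along row
  \<open>s\<close>.\<close>

lemma minor_add_row_in:
  assumes s: "s < m" "I s = Suc j" and inj: "inj_on I {..<m}"
  shows "minor (add_row e j A) m I J = minor A m I J + e * minor A m (I(s := j)) J"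
proof -
  let ?X = "Matrix.mat m m (\<lambda>(i, l). add_row e j A (I i) (J l))"
  let ?Y = "Matrix.mat m m (\<lambda>(i, l). A (I i) (J l))"
  let ?Z = "Matrix.mat m m (\<lambda>(i, l). A ((I(s := j)) i) (J l))"
  have ne: "I i \<noteq> Suc j" if "i < m" "i \<noteq> s" for i
    using that s inj by (metis inj_on_eq_iff lessThan_iff)
  have del: "mat_delete ?X s l = mat_delete ?Y s l" "mat_delete ?Z s l = mat_delete ?Y s l" for l
    unfolding mat_delete_def by (rule eq_matI; use ne in \<open>auto simp: add_row_def\<close>)+
  have cof: "cofactor ?X s l = cofactor ?Y s l" "cofactor ?Z s l = cofactor ?Y s l" for l
    unfolding cofactor_def del by simp_all
  have "Determinant.det ?X = (\<Sum>l<m. ?X $$ (s, l) * cofactor ?Y s l)"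
    using laplace_expansion_row[of ?X m s] s by (simp add: cof)
  also have "\<dots> = (\<Sum>l<m. ?Y $$ (s, l) * cofactor ?Y s l) + e * (\<Sum>l<m. ?Z $$ (s, l) * cofactor ?Z s l)"
    unfolding cof sum_distrib_left sum.distrib[symmetric]
    by (rule sum.cong) (use s in \<open>auto simp: add_row_def algebra_simps\<close>)
  also have "\<dots> = Determinant.det ?Y + e * Determinant.det ?Z"
    using laplace_expansion_row[of ?Y m s] laplace_expansion_row[of ?Z m s] s by simp
  finally show ?thesis by (simp add: minor_def)
qed

lemma minor_repeated_row:
  assumes "s < m" "t < m" "s \<noteq> t" "I s = I t"
  shows "minor A m I J = 0"
  unfolding minor_def
  by (rule Determinant.det_identical_rows[of _ m s t]) (use assms in \<open>auto intro!: eq_vecI\<close>)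

lemma minor_nonneg:
  assumes "totally_nonnegative (enat M) A" "strict_mono_on {..<m} I" "strict_mono_on {..<m} J"
    "\<And>i. i < m \<Longrightarrow> I i \<le> M" "\<And>i. i < m \<Longrightarrow> J i \<le> M"
  shows "0 \<le> minor A m I J"
  using assms by (simp add: totally_nonnegative_def)

text \<open>If row \<open>j\<close> is not among the rows \<open>I\<close>, replacing \<open>Suc j\<close> by \<open>j\<close> keeps \<open>I\<close> increasing;
  otherwise the additional minor has a repeated row.\<close>

lemma minor_add_row_mono:
  assumes tn: "totally_nonnegative (enat M) A" and e: "0 \<le> e"
    and I: "strict_mono_on {..<m} I" and J: "strict_mono_on {..<m} J"
    and IM: "\<And>i. i < m \<Longrightarrow> I i \<le> M" and JM: "\<And>i. i < m \<Longrightarrow> J i \<le> M"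
  shows "minor A m I J \<le> minor (add_row e j A) m I J"
proof (cases "\<exists>s<m. I s = Suc j")
  case False
  thus ?thesis using minor_add_row_notin[of m I j e A J] by auto
next
  case True
  then obtain s where s: "s < m" "I s = Suc j" by blast
  have inj: "inj_on I {..<m}" using I by (rule strict_mono_on_imp_inj_on)
  have "0 \<le> minor A m (I(s := j)) J"
  proof (cases "\<exists>t<m. I t = j")
    case True
    then obtain t where t: "t < m" "I t = j" by blast
    hence "minor A m (I(s := j)) J = 0"
      by (intro minor_repeated_row[of s m t]) (use s in auto)
    thus ?thesis by simp
  next
    case False
    have "strict_mono_on {..<m} (I(s := j))"
    proof (rule strict_mono_onI)
      fix x y assume xy: "x \<in> {..<m}" "y \<in> {..<m}" "x < y"
      hence "I x < I y" using I by (simp add: strict_mono_onD)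
      moreover have "I x \<noteq> j" "I y \<noteq> j" using False xy by auto
      ultimately show "(I(s := j)) x < (I(s := j)) y"
        using s xy by (auto simp: less_Suc_eq)
    qed
    moreover have "(I(s := j)) i \<le> M" if "i < m" for i
      using IM[OF that] IM[OF s(1)] s by auto
    ultimately show ?thesis using minor_nonneg[OF tn _ J _ JM] by simp
  qed
  thus ?thesis using minor_add_row_in[OF s inj, of e A J] e by simp
qed

lemma totally_nonnegative_add_row:
  assumes "totally_nonnegative (enat M) A" "0 \<le> e"
  shows "totally_nonnegative (enat M) (add_row e j A)"
  unfolding totally_nonnegative_def
proof (intro allI impI)
  fix m :: nat and I J :: "nat \<Rightarrow> nat" assume IJ: "strict_mono_on {..<m} I" "strict_mono_on {..<m} J"
    "\<forall>i<m. enat (I i) \<le> enat M \<and> enat (J i) \<le> enat M"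
  have "0 \<le> minor A m I J" using minor_nonneg[OF assms(1) IJ(1,2)] IJ(3) by simp
  also have "\<dots> \<le> minor (add_row e j A) m I J"
    using minor_add_row_mono[OF assms IJ(1,2)] IJ(3) by simp
  finally show "0 \<le> minor (add_row e j A) m I J" .
qed

lemma lower_unitriangular_add_row:
  assumes "lower_unitriangular (enat M) A" "j < M"
  shows "lower_unitriangular (enat M) (add_row e j A)"
  using assms by (auto simp: lower_unitriangular_def add_row_def)

text \<open>\<open>foldr\<close> performs the operation with the largest index first, so each row
  receives \<open>e\<close> times the original row above it. A pass is left multiplication by the
  bidiagonal matrix with \<open>1\<close> on and \<open>e\<close> below the diagonal.\<close>

definition smooth_pass :: "nat \<Rightarrow> real \<Rightarrow> (nat \<Rightarrow> nat \<Rightarrow> real) \<Rightarrow> nat \<Rightarrow> nat \<Rightarrow> real" where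
  "smooth_pass M e = foldr (add_row e) [0..<M]"

lemma totally_nonnegative_foldr_add_row:
  assumes "totally_nonnegative (enat M) A" "0 \<le> e"
  shows "totally_nonnegative (enat M) (foldr (add_row e) js A)"
  by (induction js) (auto simp: assms totally_nonnegative_add_row)

lemma minor_foldr_add_row_mono:
  assumes "totally_nonnegative (enat M) A" "0 \<le> e" "strict_mono_on {..<m} I" "strict_mono_on {..<m} J"
    "\<And>i. i < m \<Longrightarrow> I i \<le> M" "\<And>i. i < m \<Longrightarrow> J i \<le> M"
  shows "minor A m I J \<le> minor (foldr (add_row e) js A) m I J"
proof (induction js)
  case (Cons j js)
  also have "minor (foldr (add_row e) js A) m I J \<le> minor (add_row e j (foldr (add_row e) js A)) m I J"
    by (rule minor_add_row_mono) (use assms totally_nonnegative_foldr_add_row in auto)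
  finally show ?case by simp
qed simp

lemma lower_unitriangular_smooth_pass:
  assumes "lower_unitriangular (enat M) A"
  shows "lower_unitriangular (enat M) (smooth_pass M e A)"
proof -
  have "set js \<subseteq> {..<M} \<Longrightarrow> lower_unitriangular (enat M) (foldr (add_row e) js A)" for js
    by (induction js) (auto simp: assms lower_unitriangular_add_row)
  from this[of "[0..<M]"] show ?thesis by (simp add: smooth_pass_def lessThan_atLeast0)
qed

text \<open>The pass modifies the bottom rows first, so a block of consecutive rows moves down by one
  row at a time without collisions.\<close>

lemma minor_smooth_pass_pos:
  assumes tn: "totally_nonnegative (enat M) A" and e: "0 < e" and J: "strict_mono_on {..<m} J"
    and JM: "\<And>i. i < m \<Longrightarrow> J i \<le> M" and am: "a + m \<le> M"
    and pos: "0 < minor A m (\<lambda>i. a + i) J"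
  shows "0 < minor (smooth_pass M e A) m (\<lambda>i. Suc a + i) J"
proof -
  \<comment> \<open>The selected rows once the operations with index at least \<open>j\<close> are
    done: those from row \<open>j\<close> on have already moved down.\<close>
  define I where "I j = (\<lambda>i. if j \<le> a + i then Suc (a + i) else a + i)" for j
  have mono: "strict_mono_on {..<m} (I j)" for j
    by (auto simp: I_def strict_mono_on_def)
  have IM: "I j i \<le> M" if "i < m" for i j using that am by (auto simp: I_def)
  have "0 < minor (foldr (add_row e) [j..<M] A) m (I j) J" if "j \<le> M" for j
    using that
  proof (induction rule: inc_induct)
    case base
    have "minor A m (I M) J = minor A m (\<lambda>i. a + i) J"
      by (rule minor_cong) (use am in \<open>auto simp: I_def\<close>)
    thus ?case using pos by simp
  next
    case (step j)
    let ?B = "foldr (add_row e) [Suc j..<M] A"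
    have B: "foldr (add_row e) [j..<M] A = add_row e j ?B"
      using step by (simp add: upt_conv_Cons)
    have tnB: "totally_nonnegative (enat M) ?B"
      using totally_nonnegative_foldr_add_row[OF tn] e by simp
    show ?case
    proof (cases "a \<le> j \<and> j < a + m")
      case True
      define s where "s = j - a"
      have s: "s < m" "I j s = Suc j" using True by (auto simp: s_def I_def)
      have "minor ?B m ((I j)(s := j)) J = minor ?B m (I (Suc j)) J"
        by (rule minor_cong) (use True in \<open>auto simp: I_def s_def\<close>)
      moreover have "0 \<le> minor ?B m (I j) J"
        by (rule minor_nonneg[OF tnB mono J IM JM])
      ultimately show ?thesis
        unfolding B minor_add_row_in[OF s strict_mono_on_imp_inj_on[OF mono]]
        using step e by (simp add: add_nonneg_pos)
    next
      case False
      have "minor ?B m (I j) J = minor ?B m (I (Suc j)) J"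
        by (rule minor_cong) (use False in \<open>auto simp: I_def\<close>)
      thus ?thesis unfolding B
        using minor_add_row_mono[OF tnB _ mono J IM JM, of e j j] step e by simp
    qed
  qed
  from this[of 0] show ?thesis by (simp add: I_def smooth_pass_def)
qed

text \<open>Each pass makes the minors on initial columns positive for blocks starting one row
  lower. A nonempty block starts at row \<open>M\<close> at the latest, so \<open>M\<close> passes
  suffice.\<close>

definition smoothing :: "nat \<Rightarrow> real \<Rightarrow> (nat \<Rightarrow> nat \<Rightarrow> real) \<Rightarrow> nat \<Rightarrow> nat \<Rightarrow> real" where
  "smoothing M e = smooth_pass M e ^^ M"

lemma lower_unitriangular_smoothing:
  assumes "lower_unitriangular (enat M) A"
  shows "lower_unitriangular (enat M) (smoothing M e A)"
proof -
  have "lower_unitriangular (enat M) ((smooth_pass M e ^^ t) A)" for t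
    by (induction t) (auto simp: assms lower_unitriangular_smooth_pass)
  thus ?thesis by (simp add: smoothing_def)
qed

lemma minor_smoothing_pos:
  assumes tn: "totally_nonnegative (enat M) A" and lu: "lower_unitriangular (enat M) A"
    and e: "0 < e" and am: "a + m \<le> Suc M"
  shows "0 < minor (smoothing M e A) m (\<lambda>i. a + i) (\<lambda>j. j)"
proof (cases "m = 0")
  case True
  thus ?thesis by (simp add: minor_def)
next
  case False
  have tnt: "totally_nonnegative (enat M) ((smooth_pass M e ^^ t) A)" for t
    using tn e by (induction t) (auto simp: smooth_pass_def intro: totally_nonnegative_foldr_add_row)
  have id: "strict_mono_on {..<m} (\<lambda>j::nat. j)" by (simp add: strict_mono_on_def)
  have jM: "j \<le> M" if "j < m" for j using that am by simp
  \<comment> \<open>After \<open>t\<close> passes the blocks with first row \<open>a <= t\<close>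
    are settled. For \<open>t = 0\<close> they are the leading principal minors, which equal
    \<open>1\<close>.\<close>
  have "0 < minor ((smooth_pass M e ^^ t) A) m (\<lambda>i. a + i) (\<lambda>j. j)"
    if "a \<le> t" "a + m \<le> Suc M" for t a
    using that
  proof (induction t arbitrary: a)
    case 0
    have "minor A m (\<lambda>i. i) (\<lambda>j. j) = prod_list (diag_mat (Matrix.mat m m (\<lambda>(i, j). A i j)))"
      unfolding minor_def
      by (rule det_lower_triangular[of m]) (use lu 0 in \<open>auto simp: lower_unitriangular_def\<close>)
    also have "\<dots> = 1"
      unfolding prod_list_diag_prod
      by (rule prod.neutral) (use lu 0 in \<open>auto simp: lower_unitriangular_def\<close>)
    finally show ?case using 0 by simp
  next
    case (Suc t)
    show ?case
    proof (cases "a \<le> t")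
      case True
      have "minor ((smooth_pass M e ^^ t) A) m (\<lambda>i. a + i) (\<lambda>j. j)
          \<le> minor ((smooth_pass M e ^^ Suc t) A) m (\<lambda>i. a + i) (\<lambda>j. j)"
        unfolding funpow.simps comp_def smooth_pass_def[of M e]
        by (rule minor_foldr_add_row_mono[of M])
           (use tnt[of t] e Suc.prems jM in \<open>auto simp: strict_mono_on_def smooth_pass_def\<close>)
      thus ?thesis using Suc.IH[OF True Suc.prems(2)] by simp
    next
      case False
      then obtain b where b: "a = Suc b" "b = t" using Suc.prems by (cases a) auto
      show ?thesis unfolding b(1) funpow.simps comp_def
        by (rule minor_smooth_pass_pos[OF tnt e id jM]) (use Suc b in auto)
    qed
  qed
  thus ?thesis using am False by (simp add: smoothing_def)
qed

lemma tendsto_smoothing: "((\<lambda>e. smoothing M e A n k) \<longlongrightarrow> A n k) (at_right 0)"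
proof -
  have row: "((\<lambda>e. add_row e j (X e) n k) \<longlongrightarrow> A n k) (at_right 0)"
    if "\<And>n k. ((\<lambda>e. X e n k) \<longlongrightarrow> A n k) (at_right 0)" for X j n k
  proof -
    have "((\<lambda>e. X e (Suc j) k + e * X e j k) \<longlongrightarrow> A (Suc j) k + 0 * A j k) (at_right 0)"
      by (intro tendsto_intros that)
    thus ?thesis using that by (cases "n = Suc j") (auto simp: add_row_def)
  qed
  have pass: "((\<lambda>e. foldr (add_row e) js (X e) n k) \<longlongrightarrow> A n k) (at_right 0)"
    if "\<And>n k. ((\<lambda>e. X e n k) \<longlongrightarrow> A n k) (at_right 0)" for X js n k
    using that by (induction js arbitrary: n k) (auto intro: row)
  have "((\<lambda>e. (smooth_pass M e ^^ t) A n k) \<longlongrightarrow> A n k) (at_right 0)" for t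
    by (induction t arbitrary: n k) (auto simp: smooth_pass_def intro: pass)
  thus ?thesis by (simp add: smoothing_def)
qed

section \<open>Neville elimination\<close>

text \<open>Stage \<open>Suc k\<close> clears column \<open>k\<close> below the diagonal, using the previous row of stage \<open>k\<close>
  itself rather than the row already reduced.\<close>

fun neville :: "(nat \<Rightarrow> nat \<Rightarrow> real) \<Rightarrow> nat \<Rightarrow> nat \<Rightarrow> nat \<Rightarrow> real" where
  "neville A 0 n = A n"
| "neville A (Suc k) n = (if k < n
     then (\<lambda>j. neville A k n j - neville A k n k / neville A k (n - 1) k * neville A k (n - 1) j)
     else neville A k n)"

text \<open>Stage \<open>k\<close> of row \<open>n\<close> involves only rows \<open>n - k\<close>
  to \<open>n\<close>, with coefficient \<open>1\<close> at row \<open>n\<close>. Hence stage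
  \<open>i\<close> of row \<open>a + i\<close> never leaves a block starting at row
  \<open>a\<close>.\<close>

lemma neville_combination:
  assumes "k \<le> n"
  shows "\<exists>c. c n = 1 \<and> (\<forall>m. n < m \<or> m + k < n \<longrightarrow> c m = 0) \<and>
    (\<forall>j. neville A k n j = (\<Sum>m\<le>n. c m * A m j))"
  using assms
proof (induction k arbitrary: n)
  case 0
  have "A n j = (\<Sum>m\<le>n. (if m = n then 1 else 0) * A m j)" for j
    by (simp add: if_distrib[of "\<lambda>x. x * _"] cong: if_cong)
  thus ?case by (intro exI[of _ "\<lambda>m. if m = n then 1 else 0"]) auto
next
  case (Suc k)
  then obtain n' where n: "n = Suc n'" by (cases n) auto
  obtain c where c: "c n = 1" "\<And>m. n < m \<or> m + k < n \<Longrightarrow> c m = 0"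
    "\<And>j. neville A k n j = (\<Sum>m\<le>n. c m * A m j)"
    using Suc.IH[of n] Suc.prems by auto
  obtain d where d: "\<And>m. n' < m \<or> m + k < n' \<Longrightarrow> d m = 0"
    "\<And>j. neville A k n' j = (\<Sum>m\<le>n'. d m * A m j)"
    using Suc.IH[of n'] Suc.prems n by auto
  define q where "q = neville A k n k / neville A k n' k"
  have d': "neville A k n' j = (\<Sum>m\<le>n. d m * A m j)" for j
    by (simp add: d n)
  have "neville A (Suc k) n j = (\<Sum>m\<le>n. (c m - q * d m) * A m j)" for j
  proof -
    have "neville A (Suc k) n j = neville A k n j - q * neville A k n' j"
      using Suc.prems by (simp add: q_def n)
    thus ?thesis
      by (simp add: c(3) d' sum_distrib_left sum_subtractf algebra_simps)
  qed
  thus ?case using c d n by (intro exI[of _ "\<lambda>m. c m - q * d m"]) auto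
qed

text \<open>The staircase of stages arises from the block by a lower unitriangular factor
  \<open>?C\<close> of determinant \<open>1\<close>, and by assumption it is upper
  triangular.\<close>

lemma minor_eq_prod_neville:
  assumes "\<And>i j. i \<le> k \<Longrightarrow> j < i \<Longrightarrow> neville A i (a + i) j = 0"
  shows "minor A (Suc k) (\<lambda>i. a + i) (\<lambda>j. j) = (\<Prod>i\<le>k. neville A i (a + i) i)"
proof -
  obtain c where c: "\<And>i. c i (a + i) = 1" "\<And>i m. a + i < m \<or> m < a \<Longrightarrow> c i m = 0"
    "\<And>i j. neville A i (a + i) j = (\<Sum>m\<le>a + i. c i m * A m j)"
  proof -
    have "\<forall>i. \<exists>c. c (a + i) = 1 \<and> (\<forall>m. a + i < m \<or> m + i < a + i \<longrightarrow> c m = 0) \<and>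
      (\<forall>j. neville A i (a + i) j = (\<Sum>m\<le>a + i. c m * A m j))"
      by (rule allI, rule neville_combination) simp
    from choice[OF this] show ?thesis using that by auto
  qed
  let ?Y = "Matrix.mat (Suc k) (Suc k) (\<lambda>(i, j). A (a + i) j)"
  let ?X = "Matrix.mat (Suc k) (Suc k) (\<lambda>(i, j). neville A i (a + i) j)"
  let ?C = "Matrix.mat (Suc k) (Suc k) (\<lambda>(i, l). c i (a + l))"
  have nev: "neville A i (a + i) j = (\<Sum>l<Suc k. c i (a + l) * A (a + l) j)" if "i \<le> k" for i j
  proof -
    have "(\<Sum>m\<le>a + i. c i m * A m j) = (\<Sum>m\<in>{a..<a + Suc k}. c i m * A m j)"
      by (rule sum.mono_neutral_cong) (use that c(2) in \<open>auto simp: not_le\<close>)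
    also have "\<dots> = (\<Sum>l<Suc k. c i (a + l) * A (a + l) j)"
      by (rule sum.reindex_bij_witness[of _ "\<lambda>l. a + l" "\<lambda>m. m - a"]) auto
    finally show ?thesis by (simp add: c(3))
  qed
  have "?X = ?C * ?Y"
    by (rule eq_matI) (auto simp: scalar_prod_def nev atLeast0LessThan)
  hence "Determinant.det ?X = Determinant.det ?C * Determinant.det ?Y"
    by (simp add: det_mult[of _ "Suc k"])
  also have "Determinant.det ?C = prod_list (diag_mat ?C)"
    by (rule det_lower_triangular[of "Suc k"]) (auto simp: c(2))
  also have "\<dots> = 1"
    unfolding prod_list_diag_prod by (rule prod.neutral) (auto simp: c(1))
  finally have "minor A (Suc k) (\<lambda>i. a + i) (\<lambda>j. j) = Determinant.det ?X" by (simp add: minor_def)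
  also have "\<dots> = prod_list (diag_mat ?X)"
    by (rule det_upper_triangular[of _ "Suc k"]) (use assms in auto)
  also have "\<dots> = (\<Prod>i\<le>k. neville A i (a + i) i)"
    unfolding prod_list_diag_prod by (rule prod.cong) auto
  finally show ?thesis .
qed

text \<open>The product of the pivots is a positive initial minor and the earlier pivots are
  positive by induction, so the last one is positive too.\<close>

lemma neville_pos_zero:
  assumes pos: "\<And>a k. a + k \<le> M \<Longrightarrow> 0 < minor A (Suc k) (\<lambda>i. a + i) (\<lambda>j. j)"
    and "k \<le> n" "n \<le> M"
  shows "0 < neville A k n k \<and> (\<forall>j<k. neville A k n j = 0)"
  using assms(2,3)
proof (induction k arbitrary: n rule: less_induct)
  case (less k)
  \<comment> \<open>Stage \<open>k = Suc l\<close> clears column \<open>l\<close> because its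
    divisor, a pivot of stage \<open>l\<close>, is nonzero by induction. Earlier columns already
    vanish in both rows.\<close>
  have zero: "neville A k n j = 0" if "j < k" "k \<le> n" "n \<le> M" for n j
  proof -
    obtain l where k: "k = Suc l" using \<open>j < k\<close> by (cases k) auto
    have IH: "0 < neville A l m l \<and> (\<forall>j<l. neville A l m j = 0)" if "l \<le> m" "m \<le> M" for m
      using less.IH[of l m] that k by simp
    have "l \<le> n - 1" "n - 1 \<le> M" using that k by auto
    thus ?thesis using IH[of n] IH[of "n - 1"] that k by (cases "j = l") auto
  qed
  define a where "a = n - k"
  have n: "n = a + k" using less.prems by (simp add: a_def)
  have "minor A (Suc k) (\<lambda>i. a + i) (\<lambda>j. j) = (\<Prod>i\<le>k. neville A i (a + i) i)"
  proof (rule minor_eq_prod_neville)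
    fix i j assume "i \<le> k" "j < i"
    thus "neville A i (a + i) j = 0"
      using less.IH[of i "a + i"] less.prems zero[of j "a + i"] n by (cases "i = k") auto
  qed
  also have "\<dots> = (\<Prod>i<k. neville A i (a + i) i) * neville A k n k"
    by (simp add: n flip: lessThan_Suc_atMost)
  finally have "0 < (\<Prod>i<k. neville A i (a + i) i) * neville A k n k"
    using pos[of a k] less.prems n by simp
  moreover have "0 < (\<Prod>i<k. neville A i (a + i) i)"
    by (rule prod_pos) (use less.IH less.prems n in auto)
  ultimately show ?case using zero less.prems by (auto simp: zero_less_mult_iff)
qed

text \<open>The row subtracted from row \<open>n\<close> is row \<open>n - 1\<close>, which vanishes
  from column \<open>n\<close> on, so these entries never change.\<close>

lemma neville_upper:
  assumes "lower_unitriangular (enat M) A" "n \<le> j" "j \<le> M"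
  shows "neville A k n j = (if n = j then 1 else 0)"
  using assms(2,3)
proof (induction k arbitrary: n)
  case 0
  thus ?case using assms(1) by (auto simp: lower_unitriangular_def)
next
  case (Suc k)
  show ?case using Suc.IH[of n] Suc.IH[of "n - 1"] Suc.prems by auto
qed

section \<open>Interlacing at a point of the upper half plane\<close>

text \<open>If \<open>f\<close> and \<open>g\<close> are nonzero and \<open>Im z > 0\<close>, this says that
  \<open>arg f \<le> arg g \<le> arg f + arg (z / (1 + z))\<close>. For polynomials of equal degree with zeros in
  \<open>[-1, 0]\<close>, it expresses interlacing at the point \<open>z\<close>. Unlike interlacing itself, it is closed
  under limits without any condition on degrees.\<close>

definition arg_le :: "complex \<Rightarrow> complex \<Rightarrow> complex \<Rightarrow> bool" where
  "arg_le z f g \<longleftrightarrow> 0 \<le> Im (g * cnj f) \<and> 0 \<le> Im (z * (1 + cnj z) * f * cnj g)"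

lemma arg_le_refl: "0 \<le> Im z \<Longrightarrow> arg_le z f f"
proof -
  assume z: "0 \<le> Im z"
  have "Im (z * (1 + cnj z) * f * cnj f) = Im z * (cmod f)\<^sup>2"
    by (simp add: cmod_power2) (simp add: algebra_simps power2_eq_square)
  thus ?thesis using z by (simp add: arg_le_def)
qed

text \<open>Both conditions are real-linear in \<open>g\<close> for fixed \<open>f\<close>.\<close>

lemma arg_le_sum_right:
  assumes "\<And>i. i \<in> S \<Longrightarrow> arg_le z f (g i)" and "\<And>i. i \<in> S \<Longrightarrow> (0::real) \<le> c i"
  shows "arg_le z f (\<Sum>i\<in>S. of_real (c i) * g i)"
proof -
  have "Im ((\<Sum>i\<in>S. of_real (c i) * g i) * cnj f) = (\<Sum>i\<in>S. c i * Im (g i * cnj f))"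
    unfolding sum_distrib_right Im_sum by (rule sum.cong) (auto simp: algebra_simps)
  moreover have "Im (z * (1 + cnj z) * f * cnj (\<Sum>i\<in>S. of_real (c i) * g i))
      = (\<Sum>i\<in>S. c i * Im (z * (1 + cnj z) * f * cnj (g i)))"
    unfolding cnj_sum sum_distrib_left Im_sum by (rule sum.cong) (auto simp: algebra_simps)
  ultimately show ?thesis
    using assms by (auto simp: arg_le_def intro!: sum_nonneg mult_nonneg_nonneg)
qed

lemma arg_le_sum_left:
  assumes "\<And>i. i \<in> S \<Longrightarrow> arg_le z (f i) g" and "\<And>i. i \<in> S \<Longrightarrow> (0::real) \<le> c i"
  shows "arg_le z (\<Sum>i\<in>S. of_real (c i) * f i) g"
proof -
  have "Im (g * cnj (\<Sum>i\<in>S. of_real (c i) * f i)) = (\<Sum>i\<in>S. c i * Im (g * cnj (f i)))"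
    unfolding cnj_sum sum_distrib_left Im_sum by (rule sum.cong) (auto simp: algebra_simps)
  moreover have "Im (z * (1 + cnj z) * (\<Sum>i\<in>S. of_real (c i) * f i) * cnj g)
      = (\<Sum>i\<in>S. c i * Im (z * (1 + cnj z) * f i * cnj g))"
    unfolding sum_distrib_left sum_distrib_right Im_sum by (rule sum.cong) (auto simp: algebra_simps)
  ultimately show ?thesis
    using assms by (auto simp: arg_le_def intro!: sum_nonneg mult_nonneg_nonneg)
qed

text \<open>The number \<open>z * (1 + cnj z)\<close> has real part
  \<open>Re z + (cmod z)\<^sup>2\<close> and imaginary part \<open>Im z\<close>, so this is the
  second condition in coordinates.\<close>

lemma arg_le_Im_bound:
  assumes "arg_le z f g"
  shows "(Re z + (cmod z)\<^sup>2) * Im (g * cnj f) \<le> Im z * Re (g * cnj f)"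
proof -
  have u: "f * cnj g = cnj (g * cnj f)" by simp
  have "Im (z * ((1 + cnj z) * cnj v)) = Im z * Re v - (Re z + (cmod z)\<^sup>2) * Im v" for v
    by (simp only: cmod_power2) (simp add: algebra_simps power2_eq_square)
  from this[of "g * cnj f"] show ?thesis
    using assms unfolding arg_le_def mult.assoc u by simp
qed

text \<open>The permitted difference of arguments is \<open>arg z - arg (1 + z)\<close>. So for
  nonzero values \<open>arg g <= arg f + arg z\<close>, and \<open>(1 + z) * g\<close> still exceeds
  \<open>f\<close> in argument by less than \<open>pi\<close>.\<close>

lemma arg_le_Im_mult:
  assumes "arg_le z f g" "0 < Im z"
  shows "0 \<le> Im (z * f * cnj g)" and "0 \<le> Im ((1 + z) * g * cnj f)"
proof -
  let ?u = "g * cnj f"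
  have u: "f * cnj g = cnj ?u" by simp
  have b: "0 \<le> Im ?u" using assms by (simp add: arg_le_def)
  have ya: "(Re z + (cmod z)\<^sup>2) * Im ?u \<le> Im z * Re ?u"
    by (rule arg_le_Im_bound) fact
  have "Im (z * f * cnj g) = Im z * Re ?u - Re z * Im ?u"
    unfolding mult.assoc u by (simp add: algebra_simps)
  also have "\<dots> \<ge> (cmod z)\<^sup>2 * Im ?u"
    using ya by (simp add: algebra_simps)
  finally show "0 \<le> Im (z * f * cnj g)"
    using b by (meson mult_nonneg_nonneg order_trans zero_le_power2)
  have "Im ((1 + z) * g * cnj f) = (1 + Re z) * Im ?u + Im z * Re ?u"
    unfolding mult.assoc by (simp add: algebra_simps)
  also have "\<dots> \<ge> (1 + Re z) * Im ?u + (Re z + (cmod z)\<^sup>2) * Im ?u"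
    using ya by simp
  also have "(1 + Re z) * Im ?u + (Re z + (cmod z)\<^sup>2) * Im ?u = (cmod (1 + z))\<^sup>2 * Im ?u"
    by (simp only: cmod_power2) (simp add: algebra_simps power2_eq_square)
  finally show "0 \<le> Im ((1 + z) * g * cnj f)"
    using b by (meson mult_nonneg_nonneg order_trans zero_le_power2)
qed

text \<open>The two arguments are \<open>S + (1 + z) M\<close> and \<open>S + z M\<close> with
  \<open>S = (1 + z) A + z B\<close>; the argument of \<open>S\<close> lies between those of \<open>(1 + z) M\<close> and \<open>z M\<close>,
  whose difference is exactly the permitted one.\<close>

lemma arg_le_step:
  assumes z: "0 < Im z" and BM: "arg_le z B M" and MA: "arg_le z M A"
  shows "arg_le z ((1 + z) * (A + M) + z * B) ((1 + z) * A + z * (M + B))"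
proof -
  define S where "S = (1 + z) * A + z * B"
  have sq: "Im (c * (x * cnj x)) = (cmod x)\<^sup>2 * Im c" for c x
    by (simp only: complex_norm_square[symmetric] Im_complex_of_real)
       (simp add: mult.commute flip: of_real_power)
  \<comment> \<open>The first argument exceeds the second by \<open>M\<close>, and
    \<open>x * cnj x\<close> is real.\<close>
  have e1: "Im (((1 + z) * A + z * (M + B)) * cnj ((1 + z) * (A + M) + z * B))
    = Im ((1 + z) * A * cnj M) + Im (z * B * cnj M) + (cmod M)\<^sup>2 * Im z"
  proof -
    have "((1 + z) * A + z * (M + B)) * cnj ((1 + z) * (A + M) + z * B)
      = ((1 + z) * A + z * (M + B)) * cnj ((1 + z) * A + z * (M + B))
        + ((1 + z) * A * cnj M + z * B * cnj M + z * (M * cnj M))"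
      by (simp add: algebra_simps)
    moreover have "Im (x * cnj x) = 0" for x by simp
    ultimately show ?thesis using sq[of z M] by (metis add.left_neutral plus_complex.sel(2))
  qed
  have s1: "0 \<le> Im (S * cnj ((1 + z) * M))"
  proof -
    have "S * cnj ((1 + z) * M) = A * cnj M * ((1 + z) * cnj (1 + z)) + z * (1 + cnj z) * B * cnj M"
      by (simp add: S_def algebra_simps)
    hence "Im (S * cnj ((1 + z) * M))
      = (cmod (1 + z))\<^sup>2 * Im (A * cnj M) + Im (z * (1 + cnj z) * B * cnj M)"
      using sq[of "A * cnj M" "1 + z"] by (metis plus_complex.sel(2))
    thus ?thesis using BM MA by (simp add: arg_le_def)
  qed
  have s2: "0 \<le> Im (z * M * cnj S)"
  proof -
    have "z * M * cnj S = z * (1 + cnj z) * M * cnj A + M * cnj B * (z * cnj z)"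
      by (simp add: S_def algebra_simps)
    hence "Im (z * M * cnj S) = Im (z * (1 + cnj z) * M * cnj A) + (cmod z)\<^sup>2 * Im (M * cnj B)"
      using sq[of "M * cnj B" z] by (metis plus_complex.sel(2))
    thus ?thesis using BM MA by (simp add: arg_le_def)
  qed
  let ?w = "z * (1 + cnj z)"
  \<comment> \<open>Multiplying out gives positive multiples of the quantities in \<open>s1\<close>
    and \<open>s2\<close>, a term with imaginary part \<open>(cmod S)\<^sup>2 * Im z\<close>, and a
    real square.\<close>
  have "?w * (S + (1 + z) * M) * cnj (S + z * M) = ?w * (S * cnj S)
      + S * cnj ((1 + z) * M) * (z * cnj z) + z * M * cnj S * ((1 + z) * cnj (1 + z))
      + (z * (1 + z) * M) * cnj (z * (1 + z) * M)"
    by (simp add: algebra_simps)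
  hence "Im (?w * (S + (1 + z) * M) * cnj (S + z * M)) = (cmod S)\<^sup>2 * Im ?w
      + (cmod z)\<^sup>2 * Im (S * cnj ((1 + z) * M)) + (cmod (1 + z))\<^sup>2 * Im (z * M * cnj S)"
    using sq[of ?w S] sq[of "S * cnj ((1 + z) * M)" z] sq[of "z * M * cnj S" "1 + z"]
      sq[of 1 "z * (1 + z) * M"]
    by (simp only: plus_complex.sel(2) mult_1_left) simp
  moreover have "Im ?w = Im z" by (simp add: algebra_simps)
  ultimately have "0 \<le> Im (?w * (S + (1 + z) * M) * cnj (S + z * M))"
    using s1 s2 z by (simp del: complex_cnj_add complex_cnj_mult times_complex.sel)
  moreover have "S + (1 + z) * M = (1 + z) * (A + M) + z * B" "S + z * M = (1 + z) * A + z * (M + B)"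
    by (simp_all add: S_def algebra_simps)
  ultimately have e2: "0 \<le> Im (?w * ((1 + z) * (A + M) + z * B) * cnj ((1 + z) * A + z * (M + B)))"
    by simp
  show ?thesis unfolding arg_le_def e1
    using e2 arg_le_Im_mult(2)[OF MA z] arg_le_Im_mult(1)[OF BM z] z by simp
qed

text \<open>In the application, \<open>f k n\<close> is row \<open>n\<close> of the \<open>k\<close>-th stage of Neville elimination,
  applied to the vector of values \<open>p\<^sub>j(z)\<close>. Summing the recurrence over \<open>k\<close> and using \<open>diag\<close>
  expresses row \<open>n\<close> as \<open>(1 + z) \<Sum>\<^sub>i\<^sub>\<ge>\<^sub>k c\<^sub>i f\<^sub>i + z \<Sum>\<^sub>i\<^sub><\<^sub>k c\<^sub>i f\<^sub>i\<close> in terms of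
  row \<open>n - 1\<close>.\<close>

lemma arg_le_pyramid:
  fixes f :: "nat \<Rightarrow> nat \<Rightarrow> complex" and c :: "nat \<Rightarrow> nat \<Rightarrow> real"
  assumes z: "0 < Im z" and c: "\<And>k n. k < n \<Longrightarrow> n \<le> M \<Longrightarrow> 0 \<le> c k n"
    and rec: "\<And>k n. k < n \<Longrightarrow> n \<le> M \<Longrightarrow> f k n = f (Suc k) n + of_real (c k n) * f k (n - 1)"
    and diag: "\<And>n. 0 < n \<Longrightarrow> n \<le> M \<Longrightarrow> z * f 0 n = (1 + z) * f n n"
  shows "k \<le> l \<Longrightarrow> l \<le> n \<Longrightarrow> n \<le> M \<Longrightarrow> arg_le z (f k n) (f l n)"
    and "n < M \<Longrightarrow> arg_le z (f 0 (Suc n) - f (Suc n) (Suc n)) (f n n)"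
proof -
  define G where "G n S = (\<Sum>i\<in>S. of_real (c i (Suc n)) * f i n)" for n S
  have fG: "f k (Suc n) = f (Suc n) (Suc n) + G n {k..<Suc n}" if "k \<le> Suc n" "Suc n \<le> M" for k n
    using that(1)
  proof (induction rule: inc_induct)
    case base
    thus ?case by (simp add: G_def)
  next
    case (step k)
    have "{k..<Suc n} = insert k {Suc k..<Suc n}" using step by auto
    thus ?case using rec[of k "Suc n"] step that by (simp add: G_def)
  qed
  \<comment> \<open>Eliminating \<open>f 0 (Suc n)\<close> between \<open>fG\<close> and
    \<open>diag\<close> determines the corner \<open>f (Suc n) (Suc n)\<close> from row
    \<open>n\<close> alone.\<close>
  have diff: "f 0 (Suc n) - f (Suc n) (Suc n) = G n {0..<Suc n}"
    and top: "f (Suc n) (Suc n) = z * G n {0..<Suc n}" if "Suc n \<le> M" for n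
    using fG[of 0 n] diag[of "Suc n"] that by (auto simp: algebra_simps)
  have main: "arg_le z (f k n) (f l n)" if "k \<le> l" "l \<le> n" "n \<le> M" for k l n
    using that
  proof (induction n arbitrary: k l)
    case 0
    thus ?case using z by (simp add: arg_le_refl)
  next
    case (Suc n)
    let ?A = "G n {l..<Suc n}" and ?M = "G n {k..<l}" and ?B = "G n {0..<k}"
    have split: "G n {0..<Suc n} = ?B + ?M + ?A" "G n {k..<Suc n} = ?M + ?A"
      unfolding G_def using Suc.prems
      by (simp_all add: sum.atLeastLessThan_concat del: sum.op_ivl_Suc)
    \<comment> \<open>Combinations over earlier stages precede combinations over later ones. This
      supplies both hypotheses of \<open>arg_le_step\<close>.\<close>
    have le: "arg_le z (G n S) (G n T)"
      if "\<And>i j. i \<in> S \<Longrightarrow> j \<in> T \<Longrightarrow> i \<le> j" "S \<subseteq> {..n}" "T \<subseteq> {..n}" for S T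
      unfolding G_def
      by (intro arg_le_sum_left arg_le_sum_right Suc.IH c) (use that Suc.prems in \<open>force+\<close>)
    have "arg_le z ((1 + z) * (?A + ?M) + z * ?B) ((1 + z) * ?A + z * (?M + ?B))"
      by (intro arg_le_step z le) (use Suc.prems in auto)
    moreover have "f k (Suc n) = (1 + z) * (?A + ?M) + z * ?B"
      using fG[of k n] top[of n] split Suc.prems by (simp add: algebra_simps)
    moreover have "f l (Suc n) = (1 + z) * ?A + z * (?M + ?B)"
      using fG[of l n] top[of n] split Suc.prems by (simp add: algebra_simps)
    ultimately show ?case by simp
  qed
  show "k \<le> l \<Longrightarrow> l \<le> n \<Longrightarrow> n \<le> M \<Longrightarrow> arg_le z (f k n) (f l n)" by (rule main)
  show "arg_le z (f 0 (Suc n) - f (Suc n) (Suc n)) (f n n)" if "n < M"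
    unfolding diff[OF Suc_leI[OF that]] G_def
    by (intro arg_le_sum_left main c) (use that in auto)
qed

text \<open>The values \<open>p\<^sub>n(z)\<close> as functions of the matrix, so that the matrix
  can be perturbed without introducing new polynomials.\<close>

fun chain_value :: "(nat \<Rightarrow> nat \<Rightarrow> real) \<Rightarrow> complex \<Rightarrow> nat \<Rightarrow> complex" where
  "chain_value A z n = (if n = 0 then 1 else z * (\<Sum>k<n. of_real (A n k) * chain_value A z k))"

declare chain_value.simps [simp del]

text \<open>Stage \<open>n\<close> leaves only the diagonal \<open>1\<close> in row
  \<open>n\<close>, so \<open>f n n = q n\<close>, while \<open>f 0 n\<close> is \<open>q n\<close>
  plus \<open>q n / z\<close> for \<open>n > 0\<close>. The sum in the conclusion is thus
  \<open>q (Suc n) / z\<close>.\<close>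

lemma arg_le_chain_value_pos:
  assumes lu: "lower_unitriangular (enat M) A"
    and pos: "\<And>a k. a + k \<le> M \<Longrightarrow> 0 < minor A (Suc k) (\<lambda>i. a + i) (\<lambda>j. j)"
    and z: "0 < Im z" and n: "n < M"
  shows "arg_le z (\<Sum>k\<le>n. of_real (A (Suc n) k) * chain_value A z k) (chain_value A z n)"
proof -
  define q where "q = chain_value A z"
  define f where "f k n = (\<Sum>j\<le>n. of_real (neville A k n j) * q j)" for k n
  define c where "c k n = neville A k n k / neville A k (n - 1) k" for k n
  have nev: "0 < neville A k n k \<and> (\<forall>j<k. neville A k n j = 0)" if "k \<le> n" "n \<le> M" for k n
    by (rule neville_pos_zero[OF pos that])
  have c: "0 \<le> c k n" if "k < n" "n \<le> M" for k n
  proof -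
    have "k \<le> n - 1" "n - 1 \<le> M" using that by auto
    thus ?thesis using nev[of k n] nev[of k "n - 1"] that by (simp add: c_def)
  qed
  have rec: "f k n = f (Suc k) n + of_real (c k n) * f k (n - 1)" if kn: "k < n" "n \<le> M" for k n
  proof -
    have "neville A k (n - 1) n = 0" using neville_upper[OF lu, of "n - 1" n k] kn by simp
    hence "f k (n - 1) = (\<Sum>j\<le>n. of_real (neville A k (n - 1) j) * q j)"
      unfolding f_def by (intro sum.mono_neutral_left) (auto simp: le_less)
    moreover have "neville A k n j = neville A (Suc k) n j + c k n * neville A k (n - 1) j" for j
      using kn by (simp add: c_def)
    ultimately show ?thesis
      by (simp add: f_def sum_distrib_left sum.distrib algebra_simps del: neville.simps)
  qed
  have ff: "f n n = q n" if "n \<le> M" for n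
  proof -
    have "f n n = (\<Sum>j\<le>n. if j = n then q n else 0)"
      unfolding f_def
      by (rule sum.cong) (use nev[of n n] neville_upper[OF lu, of n n n] that in auto)
    thus ?thesis by simp
  qed
  have f0: "f 0 n = q n + (\<Sum>k<n. of_real (A n k) * q k)" if "n \<le> M" for n
    using lu that by (simp add: f_def lower_unitriangular_def flip: lessThan_Suc_atMost)
  have diag: "z * f 0 n = (1 + z) * f n n" if "0 < n" "n \<le> M" for n
  proof -
    have "q n = z * (\<Sum>k<n. of_real (A n k) * q k)"
      using that by (simp add: q_def chain_value.simps[of A z n])
    thus ?thesis using that by (simp add: f0 ff algebra_simps)
  qed
  have "arg_le z (f 0 (Suc n) - f (Suc n) (Suc n)) (f n n)"
    by (rule arg_le_pyramid(2)[OF z c rec diag n])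
  thus ?thesis using n by (simp add: f0 ff q_def lessThan_Suc_atMost)
qed

lemma arg_le_chain_value:
  assumes lu: "lower_unitriangular (enat M) A" and tn: "totally_nonnegative (enat M) A"
    and z: "0 < Im z" and n: "n < M"
  shows "arg_le z (\<Sum>k\<le>n. of_real (A (Suc n) k) * chain_value A z k) (chain_value A z n)"
proof -
  let ?S = "\<lambda>e. smoothing M e A"
  have q: "((\<lambda>e. chain_value (?S e) z m) \<longlongrightarrow> chain_value A z m) (at_right 0)" for m
  proof (induction m rule: less_induct)
    case (less m)
    have "((\<lambda>e. z * (\<Sum>k<m. of_real (?S e m k) * chain_value (?S e) z k))
        \<longlongrightarrow> z * (\<Sum>k<m. of_real (A m k) * chain_value A z k)) (at_right 0)"
      by (intro tendsto_intros tendsto_smoothing less.IH) auto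
    thus ?case unfolding chain_value.simps[of _ z m] by simp
  qed
  let ?h = "\<lambda>B. \<Sum>k\<le>n. of_real (B (Suc n) k) * chain_value B z k"
  have h: "((\<lambda>e. ?h (?S e)) \<longlongrightarrow> ?h A) (at_right 0)"
    by (intro tendsto_intros tendsto_smoothing q)
  have ev: "\<forall>\<^sub>F e in at_right 0. arg_le z (?h (?S e)) (chain_value (?S e) z n)"
    unfolding eventually_at_right_field
  proof (intro exI[of _ 1] conjI allI impI)
    fix e :: real assume e: "0 < e"
    show "arg_le z (?h (?S e)) (chain_value (?S e) z n)"
      by (intro arg_le_chain_value_pos[OF _ _ z n] lower_unitriangular_smoothing minor_smoothing_pos
            lu tn e) simp
  qed simp
  show ?thesis unfolding arg_le_def
  proof (intro conjI)
    show "0 \<le> Im (chain_value A z n * cnj (?h A))"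
      by (rule tendsto_lowerbound[of "\<lambda>e. Im (chain_value (?S e) z n * cnj (?h (?S e)))" _ "at_right 0"])
         (intro tendsto_intros q h, use ev in \<open>auto simp: arg_le_def elim: eventually_mono\<close>)
    show "0 \<le> Im (z * (1 + cnj z) * ?h A * cnj (chain_value A z n))"
      by (rule tendsto_lowerbound[of
            "\<lambda>e. Im (z * (1 + cnj z) * ?h (?S e) * cnj (chain_value (?S e) z n))" _ "at_right 0"])
         (intro tendsto_intros q h, use ev in \<open>auto simp: arg_le_def elim: eventually_mono\<close>)
  qed
qed

section \<open>Zeros of polynomials in the upper half plane\<close>

abbreviation cpoly :: "real poly \<Rightarrow> complex \<Rightarrow> complex" where
  "cpoly p \<equiv> poly (map_poly complex_of_real p)"

lemma cpoly_add: "cpoly (p + q) z = cpoly p z + cpoly q z"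
proof -
  have "map_poly complex_of_real (p + q) = map_poly of_real p + map_poly of_real q"
    by (rule poly_eqI) (simp add: coeff_map_poly)
  thus ?thesis by simp
qed

lemma cpoly_mult: "cpoly (p * q) z = cpoly p z * cpoly q z"
proof -
  have "map_poly complex_of_real (p * q) = map_poly of_real p * map_poly of_real q"
    by (rule poly_eqI) (simp add: coeff_map_poly coeff_mult)
  thus ?thesis by simp
qed

lemma cpoly_smult: "cpoly (smult c p) z = of_real c * cpoly p z"
proof -
  have "map_poly complex_of_real (smult c p) = smult (of_real c) (map_poly of_real p)"
    by (rule poly_eqI) (simp add: coeff_map_poly)
  thus ?thesis by simp
qed

lemma cpoly_sum: "cpoly (\<Sum>i\<in>S. f i) z = (\<Sum>i\<in>S. cpoly (f i) z)"
  by (induction S rule: infinite_finite_induct) (simp_all add: cpoly_add)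

lemma cpoly_of_real: "cpoly p (of_real x) = of_real (poly p x)"
  by (induction p) (simp_all add: map_poly_pCons)

lemma cpoly_linear: "cpoly [:a, 1:] z = of_real a + z"
  by (simp add: map_poly_pCons)

lemma cpoly_cnj: "cpoly p (cnj z) = cnj (cpoly p z)"
  by (induction p) (simp_all add: map_poly_pCons)

lemma map_poly_of_real_eq_0: "map_poly complex_of_real p = 0 \<longleftrightarrow> p = 0"
  by (auto simp: poly_eq_iff coeff_map_poly)

text \<open>Real-rootedness turns a complex root, which exists by the fundamental theorem of
  algebra, into a real linear factor. The product form later gives the argument of
  \<open>cpoly g z\<close> as a sum over the zeros.\<close>

lemma real_rooted_factorization:
  assumes "g \<noteq> 0" "real_rooted g"
  shows "cpoly g z = of_real (lead_coeff g) * (\<Prod>x\<in>#proots g. z - of_real x)"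
  using assms
proof (induction "degree g" arbitrary: g rule: less_induct)
  case (less g)
  show ?case
  proof (cases "degree g = 0")
    case True
    then obtain a where "g = [:a:]" by (rule degree_eq_zeroE)
    thus ?thesis by (simp add: map_poly_pCons)
  next
    case False
    hence "0 < degree (map_poly complex_of_real g)" by (simp add: degree_map_poly)
    then obtain w where w: "cpoly g w = 0" using alg_closed_imp_poly_has_root by blast
    hence "w \<in> \<real>" using less.prems by (auto simp: real_rooted_def)
    then obtain x where "w = of_real x" by (auto elim: Reals_cases)
    hence "poly g x = 0" using w by (simp add: cpoly_of_real)
    then obtain q where g: "g = [:-x, 1:] * q" by (auto simp: poly_eq_0_iff_dvd elim: dvdE)
    have q: "q \<noteq> 0" using g less.prems by auto
    have deg: "degree q < degree g" unfolding g using q by (subst degree_mult_eq) auto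
    have "real_rooted q"
      using less.prems unfolding g by (auto simp: real_rooted_def cpoly_mult simp del: mult_pCons_left)
    hence IH: "cpoly q z = of_real (lead_coeff q) * (\<Prod>y\<in>#proots q. z - of_real y)"
      using less.hyps[OF deg q] by blast
    have pr: "proots g = add_mset x (proots q)"
      using q by (simp add: g proots_mult del: mult_pCons_left)
    have "cpoly g z = (z - of_real x) * cpoly q z"
      unfolding g cpoly_mult by (simp add: map_poly_pCons)
    moreover have "lead_coeff g = lead_coeff q"
      unfolding g lead_coeff_mult by simp
    ultimately show ?thesis by (simp add: IH pr)
  qed
qed

text \<open>A holomorphic quotient with a zero is an open map there, so it takes values in every
  open half plane bordering on \<open>0\<close>.\<close>

lemma poly_quotient_takes_half_plane:
  fixes f h :: "complex poly"
  assumes h: "h \<noteq> 0" and f0: "poly f a \<noteq> 0" and h0: "poly h a = 0" and c: "c \<noteq> 0"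
    and U: "open U" "a \<in> U"
  shows "\<exists>z\<in>U. Im z \<noteq> 0 \<and> Re (c * poly h z * cnj (poly f z)) < 0"
proof -
  have "open {z. poly f z \<noteq> 0}"
    by (intro open_Collect_neq continuous_intros)
  hence "open (U \<inter> {z. poly f z \<noteq> 0})" using U by blast
  then obtain d where d: "0 < d" "ball a d \<subseteq> U \<inter> {z. poly f z \<noteq> 0}"
    using U f0 by (elim openE[of _ a]) auto
  define \<phi> where "\<phi> z = poly h z / poly f z" for z
  have hol: "\<phi> holomorphic_on ball a d"
    unfolding \<phi>_def by (intro holomorphic_intros) (use d in auto)
  have "\<not> \<phi> constant_on ball a d"
  proof
    assume "\<phi> constant_on ball a d"
    then obtain k where k: "\<And>z. z \<in> ball a d \<Longrightarrow> \<phi> z = k" by (auto simp: constant_on_def)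
    have "k = 0" using k[of a] d h0 by (simp add: \<phi>_def)
    hence "ball a d \<subseteq> {z. poly h z = 0}" using k d by (force simp: \<phi>_def)
    hence "finite (ball a d)" using poly_roots_finite[OF h] finite_subset by blast
    thus False using d uncountable_ball[of d a] countable_finite by blast
  qed
  hence "open (\<phi> ` ball a d)"
    by (intro open_mapping_thm[OF hol]) auto
  moreover have "0 \<in> \<phi> ` ball a d" using d h0 by (force simp: \<phi>_def)
  ultimately obtain e where e: "0 < e" "ball 0 e \<subseteq> \<phi> ` ball a d"
    using open_contains_ball by blast
  \<comment> \<open>The target value \<open>- t * cnj c\<close> has modulus \<open>e / 2\<close>,
    and its product with \<open>c\<close> is negative.\<close>
  define t where "t = e / (2 * cmod c)"
  have t: "0 < t" using e c by (simp add: t_def)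
  have "cmod (- of_real t * cnj c) = t * cmod c" using t by (simp add: norm_mult)
  hence "cmod (- of_real t * cnj c) < e" using e c by (simp add: t_def)
  hence "- of_real t * cnj c \<in> \<phi> ` ball a d" using e(2) by (meson mem_ball_0 subsetD)
  then obtain z where z: "z \<in> ball a d" "\<phi> z = - of_real t * cnj c" by (metis imageE)
  let ?S = "{z. Re (c * poly h z * cnj (poly f z)) < 0} \<inter> ball a d"
  have fz: "poly f z \<noteq> 0" using z d by auto
  hence "poly h z = - of_real t * cnj c * poly f z" using z by (simp add: \<phi>_def field_simps)
  hence "c * poly h z * cnj (poly f z) = - (of_real t * (c * cnj c) * (poly f z * cnj (poly f z)))"
    by (simp add: algebra_simps)
  also have "\<dots> = of_real (- (t * (cmod c)\<^sup>2 * (cmod (poly f z))\<^sup>2))"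
    by (simp add: complex_norm_square[symmetric] del: complex_mult_cnj)
  finally have "Re (c * poly h z * cnj (poly f z)) < 0"
    using t c fz by (metis Re_complex_of_real mult_pos_pos neg_less_0_iff_less zero_less_norm_iff zero_less_power)
  hence zS: "z \<in> ?S" using z by auto
  have "open ?S"
    by (intro open_Int open_Collect_less continuous_intros open_ball)
  then obtain r where r: "0 < r" "ball z r \<subseteq> ?S" using zS open_contains_ball by blast
  show ?thesis
  proof (cases "Im z = 0")
    case False
    thus ?thesis using zS d by auto
  next
    case True
    \<comment> \<open>The inequality is an open condition, so a real point can be pushed off the
      axis.\<close>
    let ?w = "z + of_real (r / 2) * \<i>"
    have "?w \<in> ball z r" using r by (simp add: dist_norm norm_mult)
    hence "?w \<in> ?S" using r by blast
    moreover have "Im ?w \<noteq> 0" using True r by simp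
    ultimately show ?thesis using d by blast
  qed
qed

lemma zeros_in_segment:
  assumes f: "\<And>z. cpoly f z = 0 \<Longrightarrow> z \<in> complex_of_real ` {-1..0}" and h: "h \<noteq> 0"
    and le: "\<And>z. 0 < Im z \<Longrightarrow> arg_le z (cpoly h z) (cpoly f z)"
    and zero: "cpoly h z0 = 0"
  shows "z0 \<in> complex_of_real ` {-1..0}"
proof (rule ccontr)
  assume z0: "z0 \<notin> complex_of_real ` {-1..0}"
  have h': "map_poly complex_of_real h \<noteq> 0" using h by (simp add: map_poly_of_real_eq_0)
  have no_upper: False if a: "0 < Im a" "cpoly h a = 0" for a
  proof -
    have "cpoly f a \<noteq> 0" using f[of a] a by auto
    from poly_quotient_takes_half_plane[OF h' this a(2), of \<i> "{z. 0 < Im z}"] a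
    obtain z where "0 < Im z" "Re (\<i> * cpoly h z * cnj (cpoly f z)) < 0"
      by (auto simp: open_halfspace_Im_gt)
    thus False using le[of z] by (simp add: arg_le_def algebra_simps)
  qed
  have "\<not> 0 < Im z0" "\<not> Im z0 < 0"
    using no_upper[of z0] no_upper[of "cnj z0"] zero by (auto simp: cpoly_cnj)
  then obtain x where x: "z0 = of_real x" by (metis complex_is_Real_iff linorder_neqE_linordered_idom Reals_cases)
  \<comment> \<open>The exterior of the disc with diameter \<open>[-1, 0]\<close>. At its points in
    the upper half plane \<open>arg_le\<close> forces a nonnegative real part.\<close>
  let ?U = "{z. 0 < Re z + (cmod z)\<^sup>2}"
  have "x < -1 \<or> 0 < x" using z0 x by force
  hence "0 < x * (x + 1)" by (auto simp: zero_less_mult_iff)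
  hence "z0 \<in> ?U" by (simp add: x power2_eq_square algebra_simps)
  moreover have "open ?U" by (intro open_Collect_less continuous_intros)
  moreover have "cpoly f z0 \<noteq> 0" using f z0 by blast
  ultimately obtain z where z: "0 < Re z + (cmod z)\<^sup>2" "Im z \<noteq> 0"
    "Re (cpoly h z * cnj (cpoly f z)) < 0"
    using poly_quotient_takes_half_plane[OF h' _ zero, of "map_poly of_real f" 1 ?U] by auto
  \<comment> \<open>Real coefficients permit reflection into the upper half plane: it conjugates the
    product and keeps its real part.\<close>
  define w where "w = (if 0 < Im z then z else cnj z)"
  define u where "u = cpoly f w * cnj (cpoly h w)"
  have w: "0 < Im w" "0 < Re w + (cmod w)\<^sup>2" using z by (auto simp: w_def)
  have "Re u < 0" using z(3) by (simp add: u_def w_def cpoly_cnj algebra_simps)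
  moreover have "0 \<le> Im u" using le[OF w(1)] by (simp add: arg_le_def u_def)
  moreover have "(Re w + (cmod w)\<^sup>2) * Im u \<le> Im w * Re u"
    using arg_le_Im_bound[OF le[OF w(1)]] by (simp add: u_def)
  ultimately show False using w
    by (smt (verit) mult_nonneg_nonneg mult_pos_neg)
qed

section \<open>Interlacing from arguments\<close>

text \<open>The argument of a number in the open upper half plane, in a form whose limits at the
  real axis are easy to compute.\<close>

definition upper_arg :: "complex \<Rightarrow> real" where
  "upper_arg z = pi / 2 - arctan (Re z / Im z)"

lemma rcis_upper_arg:
  assumes "0 < Im z"
  shows "z = rcis (cmod z) (upper_arg z)"
proof -
  define t where "t = Re z / Im z"
  have Re: "Re z = t * Im z" using assms by (simp add: t_def)
  have "(cmod z)\<^sup>2 = (Im z * sqrt (1 + t\<^sup>2))\<^sup>2"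
    by (simp add: cmod_power2 Re power_mult_distrib algebra_simps)
  moreover have "0 \<le> Im z * sqrt (1 + t\<^sup>2)" using assms by simp
  ultimately have cmod: "cmod z = Im z * sqrt (1 + t\<^sup>2)"
    by (metis norm_ge_zero power2_eq_iff_nonneg)
  have "sqrt (1 + t\<^sup>2) \<noteq> 0" by (simp add: add_nonneg_eq_0_iff)
  hence "Re z = cmod z * cos (upper_arg z)" "Im z = cmod z * sin (upper_arg z)"
    unfolding cmod upper_arg_def t_def[symmetric] cos_diff sin_diff
    by (simp_all add: sin_arctan cos_arctan Re)
  thus ?thesis by (simp add: complex_eq_iff)
qed

text \<open>An argument of the monic polynomial with zeros \<open>A\<close>, not reduced modulo
  \<open>2 * pi\<close> and therefore continuous on the upper half plane.\<close>

definition arg_sum :: "real multiset \<Rightarrow> complex \<Rightarrow> real" where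
  "arg_sum A z = (\<Sum>x\<in>#A. upper_arg (z - of_real x))"

lemma rcis_arg_sum:
  assumes "0 < Im z"
  shows "\<exists>R>0. (\<Prod>x\<in>#A. z - of_real x) = rcis R (arg_sum A z)"
proof (induction A)
  case empty
  show ?case by (intro exI[of _ 1]) (simp add: arg_sum_def rcis_def)
next
  case (add x A)
  then obtain R where R: "0 < R" "(\<Prod>x\<in>#A. z - of_real x) = rcis R (arg_sum A z)" by blast
  have im: "0 < Im (z - of_real x)" using assms by simp
  hence "0 < cmod (z - of_real x)" by force
  moreover have "(\<Prod>y\<in>#add_mset x A. z - of_real y)
      = rcis (cmod (z - of_real x) * R) (arg_sum (add_mset x A) z)"
    using rcis_upper_arg[OF im] R(2) by (simp add: arg_sum_def rcis_mult[symmetric])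
  ultimately show ?case using R(1) by (metis mult_pos_pos)
qed

lemma continuous_on_arg_sum: "continuous_on {z. 0 < Im z} (arg_sum A)"
proof (induction A)
  case empty
  show ?case by (simp add: arg_sum_def)
next
  case (add x A)
  have "continuous_on {z. 0 < Im z} (\<lambda>z. upper_arg (z - of_real x) + arg_sum A z)"
    unfolding upper_arg_def by (intro continuous_intros add.IH) auto
  thus ?case by (simp add: arg_sum_def cong: continuous_on_cong)
qed

lemma arg_sum_at_top: "((\<lambda>t. arg_sum A (Complex t 1)) \<longlongrightarrow> 0) at_top"
proof (induction A)
  case empty
  show ?case by (simp add: arg_sum_def)
next
  case (add x A)
  have "filterlim (\<lambda>t::real. t - x) at_top at_top"
    using filterlim_tendsto_add_at_top[OF tendsto_const[of "- x"] filterlim_ident] by simp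
  hence "((\<lambda>t. arctan (t - x)) \<longlongrightarrow> pi / 2) at_top"
    by (rule filterlim_compose[OF tendsto_arctan_at_top])
  hence "((\<lambda>t. pi / 2 - arctan (t - x) + arg_sum A (Complex t 1)) \<longlongrightarrow> pi / 2 - pi / 2 + 0) at_top"
    by (intro tendsto_intros add.IH)
  thus ?case by (simp add: arg_sum_def upper_arg_def)
qed

text \<open>On vertical approach to \<open>c\<close>, a zero to the right of \<open>c\<close>
  contributes \<open>pi\<close> and a zero to the left \<open>0\<close>.\<close>

lemma arg_sum_at_real:
  assumes "c \<notin># A"
  shows "((\<lambda>y. arg_sum A (Complex c y)) \<longlongrightarrow> pi * size {#x \<in># A. c < x#}) (at_right 0)"
  using assms
proof (induction A)
  case empty
  show ?case by (simp add: arg_sum_def)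
next
  case (add x A)
  have y: "filterlim (\<lambda>y::real. inverse y) at_top (at_right 0)"
    by (rule filterlim_inverse_at_top_right)
  have "((\<lambda>y. arctan ((c - x) * inverse y)) \<longlongrightarrow> (if c < x then - (pi / 2) else pi / 2)) (at_right 0)"
  proof (cases "c < x")
    case True
    have "filterlim (\<lambda>y. (c - x) * inverse y) at_bot (at_right 0)"
      by (rule filterlim_tendsto_neg_mult_at_bot[OF tendsto_const _ y]) (use True in simp)
    from filterlim_compose[OF tendsto_arctan_at_bot this] True show ?thesis by simp
  next
    case False
    have "filterlim (\<lambda>y. (c - x) * inverse y) at_top (at_right 0)"
      by (rule filterlim_tendsto_pos_mult_at_top[OF tendsto_const _ y]) (use False add.prems in auto)
    from filterlim_compose[OF tendsto_arctan_at_top this] False show ?thesis by simp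
  qed
  hence "((\<lambda>y. pi / 2 - arctan ((c - x) * inverse y) + arg_sum A (Complex c y))
    \<longlongrightarrow> pi / 2 - (if c < x then - (pi / 2) else pi / 2) + pi * size {#x \<in># A. c < x#}) (at_right 0)"
    using add by (intro tendsto_intros) auto
  moreover have "pi / 2 - (if c < x then - (pi / 2) else pi / 2) + pi * size {#x \<in># A. c < x#}
    = pi * size {#y \<in># add_mset x A. c < y#}"
    by (simp add: algebra_simps)
  moreover have "arg_sum (add_mset x A) (Complex c y)
    = pi / 2 - arctan ((c - x) * inverse y) + arg_sum A (Complex c y)" for y
    by (simp add: arg_sum_def upper_arg_def flip: divide_inverse[of "c - x" y])
  ultimately show ?case by simp
qed

text \<open>The difference of the argument sums is continuous, has nonnegative sine, and is close to
  \<open>0\<close> far to the right, so it never leaves \<open>[0, pi]\<close>.\<close>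

lemma root_counts_interlace:
  assumes f: "f \<noteq> 0" "real_rooted f" "0 < lead_coeff f" and g: "g \<noteq> 0" "real_rooted g" "0 < lead_coeff g"
    and im: "\<And>z. 0 < Im z \<Longrightarrow> 0 \<le> Im (cpoly g z * cnj (cpoly f z))"
    and c: "poly f c \<noteq> 0" "poly g c \<noteq> 0"
  shows "size {#x \<in># proots f. c < x#} \<le> size {#x \<in># proots g. c < x#}"
    and "size {#x \<in># proots g. c < x#} \<le> Suc (size {#x \<in># proots f. c < x#})"
proof -
  define \<Phi> where "\<Phi> z = arg_sum (proots g) z - arg_sum (proots f) z" for z
  let ?H = "{z. 0 < Im z}"
  have sin: "0 \<le> sin (\<Phi> z)" if z: "0 < Im z" for z
  proof -
    obtain R where R: "0 < R" "(\<Prod>x\<in>#proots f. z - of_real x) = rcis R (arg_sum (proots f) z)"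
      using rcis_arg_sum[OF z] by blast
    obtain S where S: "0 < S" "(\<Prod>x\<in>#proots g. z - of_real x) = rcis S (arg_sum (proots g) z)"
      using rcis_arg_sum[OF z] by blast
    have "cpoly f z = rcis (lead_coeff f * R) (arg_sum (proots f) z)"
      "cpoly g z = rcis (lead_coeff g * S) (arg_sum (proots g) z)"
      using R S by (simp_all add: real_rooted_factorization f g rcis_def)
    hence "cpoly g z * cnj (cpoly f z)
      = rcis ((lead_coeff g * S) * (lead_coeff f * R)) (\<Phi> z)"
      by (simp add: \<Phi>_def rcis_def cis_cnj cis_mult)
    hence "0 \<le> ((lead_coeff g * S) * (lead_coeff f * R)) * sin (\<Phi> z)"
      using im[OF z] by simp
    moreover have "0 < (lead_coeff g * S) * (lead_coeff f * R)" using R S f g by simp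
    ultimately show ?thesis by (simp only: zero_le_mult_iff) auto
  qed
  have "connected ?H" by (intro convex_connected convex_halfspace_Im_gt)
  moreover have "continuous_on ?H \<Phi>"
    unfolding \<Phi>_def by (intro continuous_intros continuous_on_arg_sum)
  ultimately have conn: "connected (\<Phi> ` ?H)" by (intro connected_continuous_image)
  have between: "\<exists>z. 0 < Im z \<and> \<Phi> z = u" if "0 < Im z" "0 < Im w" "\<Phi> z \<le> u" "u \<le> \<Phi> w" for z w u
    using connectedD_interval[OF conn, of "\<Phi> z" "\<Phi> w" u] that by auto
  have "((\<lambda>t. \<Phi> (Complex t 1)) \<longlongrightarrow> 0 - 0) at_top"
    unfolding \<Phi>_def by (intro tendsto_intros arg_sum_at_top)
  from tendstoD[OF this, of 1] have "\<forall>\<^sub>F t in at_top. \<bar>\<Phi> (Complex t 1)\<bar> < 1"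
    by (simp add: dist_real_def)
  then obtain t where t: "\<bar>\<Phi> (Complex t 1)\<bar> < 1"
    using eventually_happens'[of at_top] by (metis trivial_limit_at_top_linorder)
  define z1 where "z1 = Complex t 1"
  have z1: "0 < Im z1" "\<bar>\<Phi> z1\<bar> < 1" using t by (simp_all add: z1_def)
  have pi3: "3 < pi" using pi_gt3 by simp
  have "\<not> \<Phi> z1 < 0"
    using sin[OF z1(1)] z1(2) pi3 sin_gt_zero[of "- \<Phi> z1"] by auto
  have lower: "0 \<le> \<Phi> z" if z: "0 < Im z" for z
  proof (rule ccontr)
    assume neg: "\<not> 0 \<le> \<Phi> z"
    \<comment> \<open>The cut-off at \<open>-1\<close> keeps the value in \<open>(-pi, 0)\<close>,
      where the sine is negative; \<open>pi + 1\<close> does the same for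
      \<open>upper\<close>.\<close>
    then obtain w where "0 < Im w" "\<Phi> w = max (\<Phi> z) (- 1)"
      using between[of z z1 "max (\<Phi> z) (- 1)"] z z1 \<open>\<not> \<Phi> z1 < 0\<close> by auto
    thus False using sin[of w] neg pi3 sin_gt_zero[of "- \<Phi> w"] by (auto simp: max_def split: if_splits)
  qed
  have upper: "\<Phi> z \<le> pi" if z: "0 < Im z" for z
  proof (rule ccontr)
    assume gt: "\<not> \<Phi> z \<le> pi"
    hence "\<Phi> z1 \<le> min (\<Phi> z) (pi + 1)" using z1(2) pi3 by linarith
    then obtain w where "0 < Im w" "\<Phi> w = min (\<Phi> z) (pi + 1)"
      using between[of z1 z "min (\<Phi> z) (pi + 1)"] z z1(1) by auto
    thus False using sin[of w] gt pi3 sin_lt_zero[of "\<Phi> w"] by (auto simp: min_def split: if_splits)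
  qed
  let ?n = "size {#x \<in># proots g. c < x#}" and ?m = "size {#x \<in># proots f. c < x#}"
  have lim: "((\<lambda>y. \<Phi> (Complex c y)) \<longlongrightarrow> pi * ?n - pi * ?m) (at_right 0)"
    unfolding \<Phi>_def using c f g by (intro tendsto_intros arg_sum_at_real) auto
  have ev: "\<forall>\<^sub>F y in at_right 0. 0 < Im (Complex c y)"
    by (simp add: eventually_at_right_less)
  have "0 \<le> pi * ?n - pi * ?m"
    by (rule tendsto_lowerbound[OF lim]) (use ev in \<open>auto elim!: eventually_mono intro: lower\<close>)
  moreover have "pi * ?n - pi * ?m \<le> pi"
    by (rule tendsto_upperbound[OF lim]) (use ev in \<open>auto elim!: eventually_mono intro: upper\<close>)
  ultimately have "pi * ?m \<le> pi * ?n" "pi * ?n \<le> pi * (1 + ?m)" by (simp_all add: algebra_simps)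
  thus "?m \<le> ?n" "?n \<le> Suc ?m" by (simp_all del: of_nat_Suc)
qed

section \<open>From counts of zeros to sorted zeros\<close>

lemma size_filter_zeros_desc:
  "size {#x \<in># proots f. c < x#} = card {j. j < length (zeros_desc f) \<and> c < zeros_desc f ! j}"
proof -
  have "mset (zeros_desc f) = proots f" by (simp add: zeros_desc_def)
  hence "size {#x \<in># proots f. c < x#} = length (filter (\<lambda>x. c < x) (zeros_desc f))"
    by (metis mset_filter size_mset)
  thus ?thesis by (simp add: length_filter_conv_card)
qed

lemma zeros_desc_antimono:
  assumes "i \<le> j" "j < length (zeros_desc f)"
  shows "zeros_desc f ! j \<le> zeros_desc f ! i"
  using assms sorted_nth_mono[OF sorted_sorted_list_of_multiset[of "proots f"]]
  by (simp add: zeros_desc_def rev_nth)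

lemma size_gt_zeros_desc:
  assumes "i < length (zeros_desc f)" "c < zeros_desc f ! i"
  shows "i < size {#x \<in># proots f. c < x#}"
proof -
  have "{..i} \<subseteq> {j. j < length (zeros_desc f) \<and> c < zeros_desc f ! j}"
    using assms zeros_desc_antimono[of _ i f] by fastforce
  from card_mono[OF _ this] show ?thesis by (simp add: size_filter_zeros_desc)
qed

text \<open>For \<open>i\<close> past the end of the list the premise is vacuous and the count is at
  most the length.\<close>

lemma size_le_zeros_desc:
  assumes "i < length (zeros_desc f) \<Longrightarrow> zeros_desc f ! i \<le> c"
  shows "size {#x \<in># proots f. c < x#} \<le> i"
proof -
  have "{j. j < length (zeros_desc f) \<and> c < zeros_desc f ! j} \<subseteq> {..<i}"
    using assms zeros_desc_antimono[of i _ f] by (force simp: not_less[symmetric])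
  from card_mono[OF _ this] show ?thesis by (simp add: size_filter_zeros_desc)
qed

text \<open>A violated inequality between zeros leaves an open interval. At a point \<open>c\<close>
  of it that is a zero of neither polynomial, the counts to the right contradict
  \<open>root_counts_interlace\<close>.\<close>

lemma interlaces_from_upper_half_plane:
  assumes f: "f \<noteq> 0" "real_rooted f" "0 < lead_coeff f" and g: "g \<noteq> 0" "real_rooted g" "0 < lead_coeff g"
    and im: "\<And>z. 0 < Im z \<Longrightarrow> 0 \<le> Im (cpoly g z * cnj (cpoly f z))"
  shows "f \<prec>\<^sub>I g"
proof -
  let ?\<alpha> = "zeros_desc f" and ?\<beta> = "zeros_desc g"
  have counts: "size {#x \<in># proots f. c < x#} \<le> size {#x \<in># proots g. c < x#}"
      "size {#x \<in># proots g. c < x#} \<le> Suc (size {#x \<in># proots f. c < x#})"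
    if "poly f c \<noteq> 0" "poly g c \<noteq> 0" for c
    using root_counts_interlace[OF f g _ that] im by auto
  have fin: "finite {x. poly (f * g) x = 0}" using f g by (intro poly_roots_finite) simp
  have avoid: "\<exists>c. a < c \<and> c < b \<and> poly f c \<noteq> 0 \<and> poly g c \<noteq> 0" if "a < b" for a b :: real
  proof -
    have "infinite ({a<..<b} - {x. poly (f * g) x = 0})"
      using that fin by (simp add: infinite_Ioo)
    then obtain c where "c \<in> {a<..<b} - {x. poly (f * g) x = 0}" by (metis ex_in_conv finite.emptyI)
    thus ?thesis by auto
  qed
  have fg_le: "?\<alpha> ! i \<le> ?\<beta> ! i" if "i < length ?\<alpha>" "i < length ?\<beta>" for i
  proof (rule ccontr)
    assume "\<not> ?thesis"
    then obtain c where "?\<beta> ! i < c" "c < ?\<alpha> ! i" "poly f c \<noteq> 0" "poly g c \<noteq> 0"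
      using avoid[of "?\<beta> ! i" "?\<alpha> ! i"] by auto
    thus False using counts(1)[of c] size_gt_zeros_desc[of i f c] size_le_zeros_desc[of i g c] that by simp
  qed
  have gf_le: "?\<beta> ! (i + 1) \<le> ?\<alpha> ! i" if "i < length ?\<alpha>" "i + 1 < length ?\<beta>" for i
  proof (rule ccontr)
    assume "\<not> ?thesis"
    then obtain c where "?\<alpha> ! i < c" "c < ?\<beta> ! (i + 1)" "poly f c \<noteq> 0" "poly g c \<noteq> 0"
      using avoid[of "?\<alpha> ! i" "?\<beta> ! (i + 1)"] by auto
    thus False using counts(2)[of c] size_gt_zeros_desc[of "i + 1" g c] size_le_zeros_desc[of i f c] that by simp
  qed
  have "\<exists>l. \<forall>x\<in>{x. poly (f * g) x = 0}. l \<le> x" using fin by (metis bdd_belowI bdd_below_def bdd_below_finite)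
  then obtain l where l: "\<And>x. poly (f * g) x = 0 \<Longrightarrow> l \<le> x" by auto
  \<comment> \<open>To the left of all zeros the counts are the total numbers of zeros, hence the
    lengths.\<close>
  define c where "c = l - 1"
  have c: "poly f c \<noteq> 0" "poly g c \<noteq> 0" using l[of c] by (auto simp: c_def)
  have all: "{#x \<in># proots h. c < x#} = proots h" if "h = f \<or> h = g" for h
    using l f g that by (force simp: c_def filter_mset_eq_conv)
  have len: "length (zeros_desc h) = size (proots h)" for h
    by (simp add: zeros_desc_def flip: size_mset)
  have lengths: "length ?\<beta> = length ?\<alpha> \<or> length ?\<beta> = length ?\<alpha> + 1"
    using counts[OF c] all len by auto
  show ?thesis
    unfolding interlaces_def Let_def using f g lengths fg_le gf_le by auto
qed

section \<open>Chain polynomials\<close>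

lemma totally_nonnegative_antimono:
  "totally_nonnegative N r \<Longrightarrow> M \<le> N \<Longrightarrow> totally_nonnegative M r"
  unfolding totally_nonnegative_def by (meson order_trans)

lemma lower_unitriangular_antimono:
  "lower_unitriangular N r \<Longrightarrow> M \<le> N \<Longrightarrow> lower_unitriangular M r"
  unfolding lower_unitriangular_def by (meson order_trans)

lemma minor_1: "minor r 1 I J = r (I 0) (J 0)"
  unfolding minor_def by (subst det_single) auto

lemma minor_2: "minor r 2 I J = r (I 0) (J 0) * r (I 1) (J 1) - r (I 0) (J 1) * r (I 1) (J 0)"
proof -
  let ?A = "Matrix.mat 2 2 (\<lambda>(i, j). r (I i) (J j))"
  have expand: "Determinant.det ?A = (\<Sum>j<2. ?A $$ (0, j) * cofactor ?A 0 j)"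
    by (rule laplace_expansion_row[of _ 2]) auto
  have "Determinant.det (mat_delete ?A 0 j) = mat_delete ?A 0 j $$ (0, 0)" for j
    by (rule det_single) (auto simp: mat_delete_def)
  hence "Determinant.det ?A
      = (\<Sum>j<2. ?A $$ (0, j) * ((- 1) ^ (0 + j) * mat_delete ?A 0 j $$ (0, 0)))"
    by (simp only: expand cofactor_def)
  thus ?thesis
    by (simp add: minor_def mat_delete_def numeral_2_eq_2)
qed

lemma totally_nonnegative_entry:
  assumes "totally_nonnegative N r" "enat n \<le> N" "enat k \<le> N"
  shows "0 \<le> r n k"
proof -
  have "0 \<le> minor r 1 (\<lambda>_. n) (\<lambda>_. k)"
    using assms unfolding totally_nonnegative_def
    by (elim allE[of _ 1] allE[of _ "\<lambda>_. n"] allE[of _ "\<lambda>_. k"]) (auto simp: strict_mono_on_def)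
  thus ?thesis by (simp only: minor_1)
qed

text \<open>The minor with rows \<open>n\<close>, \<open>Suc n\<close> and columns \<open>k\<close>, \<open>n\<close>.\<close>

lemma totally_nonnegative_row_le:
  assumes tn: "totally_nonnegative N r" and lu: "lower_unitriangular N r"
    and n: "enat (Suc n) \<le> N" and k: "k < n"
  shows "r (Suc n) k \<le> r n k * r (Suc n) n"
proof -
  have le: "enat n \<le> N" "enat k \<le> N"
    using n k by (meson enat_ord_simps(1) less_imp_le_nat lessI less_SucI order_trans)+
  define I where "I i = (if i = 0 then n else Suc n)" for i :: nat
  define J where "J i = (if i = 0 then k else n)" for i :: nat
  have "0 \<le> minor r 2 I J"
    using tn n le k unfolding totally_nonnegative_def
    by (auto simp: strict_mono_on_def I_def J_def)
  thus ?thesis using lu le by (simp add: minor_2 I_def J_def lower_unitriangular_def)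
qed

theorem theorem3p7:
  fixes N :: enat and r :: "nat \<Rightarrow> nat \<Rightarrow> real" and p :: "nat \<Rightarrow> real poly"
  assumes "lower_unitriangular N r"
    and "p 0 = 1"
    and "\<And>n. 0 < n \<Longrightarrow> enat n \<le> N \<Longrightarrow> p n = [:0, 1:] * (\<Sum>k<n. smult (r n k) (p k))"
    and "totally_nonnegative N r"
  shows "(\<forall>n. enat n \<le> N \<longrightarrow> p n \<noteq> 0 \<longrightarrow>
            (\<forall>z. poly (map_poly complex_of_real (p n)) z = 0 \<longrightarrow>
                 z \<in> complex_of_real ` {-1..0})) \<and>
         (\<forall>n. enat n < N \<longrightarrow> p n \<prec>\<^sub>I p (Suc n))"
proof -
  note lu = assms(1) and tn = assms(4)
  have le_trans: "enat m \<le> N" if "m \<le> n" "enat n \<le> N" for m n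
    using that by (meson enat_ord_simps(1) order_trans)
  \<comment> \<open>The polynomial \<open>p (Suc n)\<close> without its factor \<open>t\<close>; it
    is \<open>h n\<close>, not \<open>p (Suc n)\<close>, that \<open>arg_le\<close> compares with
    \<open>p n\<close>.\<close>
  define h where "h n = (\<Sum>k\<le>n. smult (r (Suc n) k) (p k))" for n
  have p_Suc: "p (Suc n) = [:0, 1:] * h n" if "enat (Suc n) \<le> N" for n
    using assms(3)[OF _ that] by (simp add: h_def lessThan_Suc_atMost)
  have val: "cpoly (p n) z = chain_value r z n" if "enat n \<le> N" for n z
    using that
  proof (induction n rule: less_induct)
    case (less n)
    show ?case
    proof (cases "n = 0")
      case True
      thus ?thesis by (simp add: assms(2) chain_value.simps)
    next
      case False
      have "cpoly (p k) z = chain_value r z k" if "k < n" for k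
        using less.IH[OF that] le_trans[of k n] less.prems that by simp
      moreover have "cpoly (p n) z = cpoly [:0, 1:] z * (\<Sum>k<n. of_real (r n k) * cpoly (p k) z)"
        unfolding assms(3)[OF neq0_conv[THEN iffD1, OF False] less.prems] cpoly_mult cpoly_sum cpoly_smult ..
      ultimately show ?thesis
        unfolding chain_value.simps[of r z n] using False by (simp add: cpoly_linear)
    qed
  qed
  have le: "arg_le z (cpoly (h n) z) (cpoly (p n) z)" if n: "enat (Suc n) \<le> N" and z: "0 < Im z" for n z
  proof -
    have "arg_le z (\<Sum>k\<le>n. of_real (r (Suc n) k) * chain_value r z k) (chain_value r z n)"
      by (rule arg_le_chain_value[OF lower_unitriangular_antimono[OF lu n]
            totally_nonnegative_antimono[OF tn n] z]) simp
    moreover have "cpoly (h n) z = (\<Sum>k\<le>n. of_real (r (Suc n) k) * chain_value r z k)"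
      unfolding h_def cpoly_sum cpoly_smult
      by (intro sum.cong refl) (use val le_trans[OF _ n] in auto)
    ultimately show ?thesis using val[of n z] le_trans[OF _ n, of n] by simp
  qed
  have coeff_nonneg: "0 \<le> coeff (p n) i" if "enat n \<le> N" for n i
    using that
  proof (induction n arbitrary: i rule: less_induct)
    case (less n)
    show ?case
    proof (cases "n = 0")
      case True
      thus ?thesis by (simp add: assms(2))
    next
      case False
      have "0 \<le> coeff (\<Sum>k<n. smult (r n k) (p k)) j" for j
        unfolding coeff_sum coeff_smult using less le_trans[OF _ less.prems]
        by (intro sum_nonneg mult_nonneg_nonneg totally_nonnegative_entry[OF tn]) auto
      thus ?thesis using assms(3)[OF neq0_conv[THEN iffD1, OF False] less.prems]
        by (simp add: coeff_pCons split: nat.split)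
    qed
  qed
  \<comment> \<open>A zero polynomial is followed only by zeros, so the induction for
    \<open>zeros\<close> always has a nonzero predecessor. Nonnegative coefficients exclude
    cancellation, so every summand of \<open>p n\<close> vanishes, and
    \<open>totally_nonnegative_row_le\<close> carries zero entries to the next row.\<close>
  have p_zero: "p (Suc n) = 0" if n: "enat (Suc n) \<le> N" and 0: "p n = 0" for n
  proof -
    have n': "enat n \<le> N" "0 < n" using le_trans[OF _ n] 0 assms(2) by (auto intro: gr0I)
    have "smult (r n k) (p k) = 0" if k: "k < n" for k
    proof (rule poly_eqI)
      fix i
      have "(\<Sum>k<n. smult (r n k) (p k)) = 0" using assms(3)[OF n'(2,1)] 0 by simp
      hence "coeff (\<Sum>k<n. smult (r n k) (p k)) i = 0" by simp
      hence "(\<Sum>k<n. r n k * coeff (p k) i) = 0" by (simp add: coeff_sum)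
      moreover have "0 \<le> r n k * coeff (p k) i" if "k < n" for k
        using that le_trans[OF _ n'(1)] coeff_nonneg totally_nonnegative_entry[OF tn] n' by simp
      ultimately show "coeff (smult (r n k) (p k)) i = coeff 0 i"
        using sum_nonneg_0[of "{..<n}" "\<lambda>k. r n k * coeff (p k) i" k] k by simp
    qed
    moreover have "r (Suc n) k = 0" if "k < n" "r n k = 0" for k
      using totally_nonnegative_row_le[OF tn lu n that(1)] that
        totally_nonnegative_entry[OF tn n, of k] le_trans[OF _ n, of k] by simp
    ultimately have "smult (r (Suc n) k) (p k) = 0" if "k \<le> n" for k
      using 0 that by (metis le_neq_implies_less smult_0_right smult_eq_0_iff)
    hence "h n = 0" unfolding h_def by (intro sum.neutral) auto
    thus ?thesis unfolding p_Suc[OF n] by simp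
  qed
  have zeros: "z \<in> complex_of_real ` {-1..0}" if "enat n \<le> N" "p n \<noteq> 0" "cpoly (p n) z = 0" for n z
    using that
  proof (induction n arbitrary: z)
    case 0
    thus ?case by (simp add: assms(2))
  next
    case (Suc n)
    have pn: "p n \<noteq> 0" using p_zero Suc.prems by blast
    have hn: "h n \<noteq> 0" using p_Suc Suc.prems by auto
    have "z = 0 \<or> cpoly (h n) z = 0"
      using Suc.prems(3) unfolding p_Suc[OF Suc.prems(1)] cpoly_mult cpoly_linear by simp
    thus ?case
    proof
      assume "z = 0"
      thus ?thesis by (intro image_eqI[of _ _ 0]) auto
    next
      assume "cpoly (h n) z = 0"
      thus ?thesis
        using zeros_in_segment[of "p n" "h n" z] Suc.IH[OF _ pn] le_trans[OF _ Suc.prems(1), of n]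
          hn le[OF Suc.prems(1)] by simp
    qed
  qed
  have rr: "real_rooted (p n)" if "enat n \<le> N" for n
    unfolding real_rooted_def using zeros[OF that] by (metis Reals_of_real imageE)
  have lead: "0 < lead_coeff (p n)" if "enat n \<le> N" "p n \<noteq> 0" for n
    using coeff_nonneg[OF that(1), of "degree (p n)"] that(2) by (simp add: less_le)
  have "p n \<prec>\<^sub>I p (Suc n)" if "enat n < N" for n
  proof -
    have n: "enat (Suc n) \<le> N" "enat n \<le> N" using that by (auto simp: Suc_ile_eq)
    show ?thesis
    proof (cases "p n = 0 \<or> p (Suc n) = 0")
      case True
      thus ?thesis using rr n by (auto simp: interlaces_def)
    next
      case False
      show ?thesis
      proof (rule interlaces_from_upper_half_plane)
        fix z :: complex assume z: "0 < Im z"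
        have "cpoly (p (Suc n)) z = z * cpoly (h n) z"
          unfolding p_Suc[OF n(1)] cpoly_mult cpoly_linear by simp
        thus "0 \<le> Im (cpoly (p (Suc n)) z * cnj (cpoly (p n) z))"
          using arg_le_Im_mult(1)[OF le[OF n(1) z] z] by simp
      qed (use False rr lead n in auto)
    qed
  qed
  thus ?thesis using zeros by blast
qed

end
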